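(* Let $e_1,\dots,e_6$ be the standard basis of $\mathbb R^6$ and let $\Delta\subset\mathbb R^6$ be the monotone polytope $\Delta=\{x\in\mathbb R^6:\langle\eta_i,x\rangle\le 1,\ i=1,\dots,9\}$ with conormals $$\eta_i=-e_i\ (i=1,\dots,6),\quad \eta_7=e_6,\quad \eta_8=(1,1,0,0,1,3),\quad \eta_9=(0,0,1,1,1,2).$$ Let $F_i$ be the facet of $\Delta$ with conormal $\eta_i$. Then $\Delta$ does not satisfy the star-Ewald condition at the vertex $z=F_1\cap F_2\cap F_3\cap F_4\cap F_8\cap F_9$.
   Context: For an integral polytope $\Delta\subset\mathbb R^n$ with $\{0\}$ in its interior, let $\mathcal S(\Delta)=\{v\in\mathbb Z^n\cap\Delta: -v\in\Delta\}\setminus\{0\}$ be the set of nonzero integral symmetric points of $\Delta$. The star-Ewald condition at a vertex $z$ of $\Delta$ says that there is a point $w\in\mathcal S(\Delta)$ that lies in precisely one of the facets through $z$ and is such that $-w$ lies on no facet through $z$. A polytope is monotone if it is the moment polytope of a toric symplectic manifold $(M,\omega)$ with $[\omega]=c_1(M)$; equivalently (after translation) it is a smooth integral polytope with all support constants equal to $1$. *)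

theory Defs
  imports "HOL-Analysis.Analysis"
begin

definition integral_vectors :: "(real ^ 'n) set" where
  "integral_vectors = {v. \<forall>i. v $ i \<in> \<int>}"

definition primitive_vector :: "real ^ 'n \<Rightarrow> bool" where
  "primitive_vector v \<longleftrightarrow> v \<in> integral_vectors \<and>
     (\<forall>(k::int). \<forall>u \<in> integral_vectors. v = of_int k *\<^sub>R u \<longrightarrow> \<bar>k\<bar> = 1)"

definition lattice_basis :: "(real ^ 'n) set \<Rightarrow> bool" where
  "lattice_basis B \<longleftrightarrow> B \<subseteq> integral_vectors \<and> independent B \<and>
     (\<forall>v \<in> integral_vectors. \<exists>c :: real ^ 'n \<Rightarrow> int. v = (\<Sum>b\<in>B. of_int (c b) *\<^sub>R b))"

text \<open>The facet \<open>F\<close> of \<open>P\<close> has primitive integral outward conormal \<open>\<eta>\<close> and support constant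
  \<open>\<kappa>\<close>. For a facet of a full-dimensional polytope there is at most one such pair.\<close>

definition conormal_of_facet ::
    "(real ^ 'n) set \<Rightarrow> (real ^ 'n) set \<Rightarrow> real ^ 'n \<Rightarrow> real \<Rightarrow> bool" where
  "conormal_of_facet P F \<eta> \<kappa> \<longleftrightarrow> F facet_of P \<and> primitive_vector \<eta> \<and>
     (\<forall>x\<in>P. \<eta> \<bullet> x \<le> \<kappa>) \<and> F = {x \<in> P. \<eta> \<bullet> x = \<kappa>}"

definition integral_polytope :: "(real ^ 'n) set \<Rightarrow> bool" where
  "integral_polytope P \<longleftrightarrow> polytope P \<and> (\<forall>v. v extreme_point_of P \<longrightarrow> v \<in> integral_vectors)"

text \<open>Smooth (Delzant) polytopes: full-dimensional, rational (every facet has an integral conormal),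
  simple, and at each vertex the conormals of the facets through it form a basis of the lattice.\<close>

definition smooth_polytope :: "(real ^ 'n) set \<Rightarrow> bool" where
  "smooth_polytope P \<longleftrightarrow> polytope P \<and> interior P \<noteq> {} \<and>
     (\<forall>F. F facet_of P \<longrightarrow> (\<exists>\<eta> \<kappa>. conormal_of_facet P F \<eta> \<kappa>)) \<and>
     (\<forall>v. v extreme_point_of P \<longrightarrow>
        card {F. F facet_of P \<and> v \<in> F} = CARD('n) \<and>
        lattice_basis {\<eta>. \<exists>F \<kappa>. v \<in> F \<and> conormal_of_facet P F \<eta> \<kappa>})"

text \<open>Moment polytopes of monotone toric symplectic manifolds, in the combinatorial description
  and with the translation normalised so that every support constant equals 1.\<close>

definition monotone_polytope :: "(real ^ 'n) set \<Rightarrow> bool" where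
  "monotone_polytope P \<longleftrightarrow> smooth_polytope P \<and> integral_polytope P \<and>
     (\<forall>F \<eta> \<kappa>. conormal_of_facet P F \<eta> \<kappa> \<longrightarrow> \<kappa> = 1)"

definition symmetric_points :: "(real ^ 'n) set \<Rightarrow> (real ^ 'n) set" where
  "symmetric_points P = {v \<in> integral_vectors \<inter> P. - v \<in> P} - {0}"

definition star_Ewald_at :: "(real ^ 'n) set \<Rightarrow> real ^ 'n \<Rightarrow> bool" where
  "star_Ewald_at P z \<longleftrightarrow> (\<exists>w \<in> symmetric_points P.
     (\<exists>!F. F facet_of P \<and> z \<in> F \<and> w \<in> F) \<and>
     (\<forall>F. F facet_of P \<and> z \<in> F \<longrightarrow> - w \<notin> F))"

text \<open>The index type \<open>6\<close> of \<open>real ^ 6\<close> is the integers modulo 6, so its elements are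
  \<open>1, \<dots>, 6\<close> (with \<open>6 = 0\<close>), and \<open>axis (of_nat i) 1\<close> is the \<open>i\<close>-th standard basis vector for
  \<open>i = 1, \<dots>, 6\<close>. Only the values \<open>eta 1, \<dots>, eta 9\<close> are meaningful.\<close>

definition eta :: "nat \<Rightarrow> real ^ 6" where
  "eta i = (if i \<le> 6 then - axis (of_nat i) 1
            else if i = 7 then axis 6 1
            else if i = 8 then vector [1, 1, 0, 0, 1, 3]
            else vector [0, 0, 1, 1, 1, 2])"

definition Delta :: "(real ^ 6) set" where
  "Delta = {x. \<forall>i \<in> {1..9}. eta i \<bullet> x \<le> 1}"

definition Delta_facet :: "nat \<Rightarrow> (real ^ 6) set" where
  "Delta_facet i = {x \<in> Delta. eta i \<bullet> x = 1}"

end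

theory Submission
  imports Defs
begin

text \<open>Write \<open>s i = 1 - eta i \<bullet> x\<close> for the slack of the \<open>i\<close>-th inequality. The conormals
  satisfy three linear relations,
    \<open>eta 6 + eta 7 = 0\<close>,
    \<open>eta 1 + eta 2 + eta 8 + eta 5 + 3 eta 6 = 0\<close> and
    \<open>eta 3 + eta 4 + eta 9 + eta 5 + 2 eta 6 = 0\<close>,
  so the slacks of a point satisfy
    \<open>s 6 + s 7 = 2\<close>, \<open>s 1 + s 2 + s 8 + s 5 + 3 s 6 = 7\<close>, \<open>s 3 + s 4 + s 9 + s 5 + 2 s 6 = 6\<close>,
  and the polytope is the set of nonnegative solutions of these three equations. The indices
  fall into the groups \<open>{1, 2, 8}\<close>, \<open>{3, 4, 9}\<close>, \<open>{5}\<close>, \<open>{6, 7}\<close>.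

  At a vertex no nonzero solution of the homogeneous equations is supported on the positive slacks.
  Explicit solutions therefore restrict the set of positive slacks to a short list of
  three-element sets (\<open>basic_support\<close>, \<open>vertex_basic_support\<close>). For each of them the three
  relations can be solved over the integers for the three missing conormals
  (\<open>eta_in_vertex_span\<close>), so the six conormals at the vertex generate the lattice. This gives
  smoothness, and integrality of the vertex follows because its inner products with a lattice basis
  all equal 1.

  For the facets themselves, every one of the nine inequalities is irredundant
  (\<open>eta_irredundant\<close>), so they define exactly the nine facets (\<open>facet_of_Delta\<close>). A facet spans
  a hyperplane, which determines the primitive outward conormal and the support constant
  (\<open>conormal_of_facet_unique\<close>); hence all support constants are 1.

  The vertex is \<open>z = (-1, -1, -1, -1, 3, 0)\<close>. A point \<open>w\<close> witnessing the star-Ewald condition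
  has integral inner products of absolute value at most 1 with the conormals at \<open>z\<close>; exactly one of
  them is 1 and none is -1, so the other five vanish. Solving for \<open>w\<close> then gives an
  \<open>e 5\<close>-coordinate of -2 or 3, which is impossible for a symmetric point
  (\<open>no_symmetric_point_with_one_active\<close>).\<close>

section \<open>Polyhedra and their facets\<close>

text \<open>Each inequality has a point that violates it alone, so no proper subsystem describes \<open>P\<close>.
  The same points show that distinct indices give distinct half-spaces, so the system can be
  treated as a set of half-spaces.\<close>

lemma facet_of_irredundant_system:
  fixes a :: "'i \<Rightarrow> 'a::euclidean_space"
  assumes "finite I" and P: "P = {x. \<forall>i\<in>I. a i \<bullet> x \<le> b i}" and int: "interior P \<noteq> {}"
    and irredundant: "\<And>i. i \<in> I \<Longrightarrow> \<exists>x. a i \<bullet> x > b i \<and> (\<forall>j\<in>I - {i}. a j \<bullet> x \<le> b j)"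
  shows "F facet_of P \<longleftrightarrow> (\<exists>i\<in>I. F = {x \<in> P. a i \<bullet> x = b i})"
proof -
  define H where "H i = {x. a i \<bullet> x \<le> b i}" for i
  define g where "g = inv_into I H"
  have inj: "inj_on H I"
  proof (rule inj_onI, rule ccontr)
    fix i j assume ij: "i \<in> I" "j \<in> I" "H i = H j" "i \<noteq> j"
    from irredundant[OF ij(1)] ij obtain x where "x \<notin> H i" "x \<in> H j"
      by (auto simp: H_def not_le)
    with ij show False by blast
  qed
  have g: "g (H i) = i" if "i \<in> I" for i
    unfolding g_def using inj that by simp
  have hull: "affine hull P = UNIV"
    using int by (rule affine_hull_nonempty_interior)
  have nz: "a i \<noteq> 0" if "i \<in> I" for i
  proof
    assume "a i = 0"
    moreover from int obtain x where "x \<in> P" using interior_subset by blast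
    then have "a i \<bullet> x \<le> b i" using that P by blast
    moreover from irredundant[OF that] obtain y where "a i \<bullet> y > b i" by blast
    ultimately show False by simp
  qed
  have "F facet_of P \<longleftrightarrow> (\<exists>h. h \<in> H ` I \<and> F = P \<inter> {x. a (g h) \<bullet> x = b (g h)})"
  proof (rule facet_of_polyhedron_explicit)
    show "finite (H ` I)" using \<open>finite I\<close> by simp
    show "P = affine hull P \<inter> \<Inter> (H ` I)"
      unfolding hull by (auto simp: P H_def)
    show "a (g h) \<noteq> 0 \<and> h = {x. a (g h) \<bullet> x \<le> b (g h)}" if "h \<in> H ` I" for h
      using that g nz by (auto simp: H_def)
    fix F' assume F': "F' \<subset> H ` I"
    then obtain i where i: "i \<in> I" "H i \<notin> F'" by blast
    from irredundant[OF i(1)] obtain x where x: "a i \<bullet> x > b i" "\<forall>j\<in>I - {i}. a j \<bullet> x \<le> b j"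
      by blast
    have "x \<in> h" if "h \<in> F'" for h
    proof -
      from that F' obtain j where "j \<in> I" "h = H j" by blast
      with i that x(2) show ?thesis by (auto simp: H_def)
    qed
    moreover have "x \<notin> P" using x(1) i(1) by (auto simp: P not_le)
    moreover have "P \<subseteq> \<Inter> F'" using F' by (fastforce simp: P H_def)
    ultimately show "P \<subset> affine hull P \<inter> \<Inter> F'" unfolding hull by blast
  qed
  then show ?thesis using g by auto
qed

text \<open>The affine hull lies in the hyperplane, and both have codimension one.\<close>

lemma affine_hull_facet:
  fixes P :: "'a::euclidean_space set"
  assumes F: "F facet_of P" and int: "interior P \<noteq> {}"
    and sub: "F \<subseteq> {x. a \<bullet> x = b}" and nz: "a \<noteq> 0"
  shows "affine hull F = {x. a \<bullet> x = b}"
proof (rule ccontr)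
  assume "affine hull F \<noteq> {x. a \<bullet> x = b}"
  moreover have "affine hull F \<subseteq> {x. a \<bullet> x = b}"
    using sub by (rule hull_minimal) (rule affine_hyperplane)
  moreover have hull: "affine hull {x. a \<bullet> x = b} = {x. a \<bullet> x = b}"
    using affine_hyperplane by (rule hull_same)
  ultimately have "affine hull F \<subset> affine hull {x. a \<bullet> x = b}" by blast
  then have "aff_dim F < aff_dim {x. a \<bullet> x = b}" by (rule aff_dim_psubset)
  moreover have "aff_dim P = int DIM('a)"
    using affine_hull_nonempty_interior[OF int] by (simp add: aff_dim_eq_full)
  ultimately show False using F nz by (simp add: facet_of_def)
qed

text \<open>Along such a direction \<open>d\<close> the tight constraints stay tight and the others have room, so
  \<open>v\<close> would be the midpoint of two points \<open>v - t d\<close> and \<open>v + t d\<close> of the polyhedron.\<close>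

lemma extreme_point_no_direction:
  fixes a :: "'i \<Rightarrow> 'a::euclidean_space"
  assumes "finite I" and v: "v extreme_point_of {x. \<forall>i\<in>I. a i \<bullet> x \<le> b i}"
    and d: "\<And>i. i \<in> I \<Longrightarrow> a i \<bullet> v = b i \<Longrightarrow> a i \<bullet> d = 0"
  shows "d = 0"
proof (rule ccontr)
  assume "d \<noteq> 0"
  let ?P = "{x. \<forall>i\<in>I. a i \<bullet> x \<le> b i}"
  have vP: "a i \<bullet> v \<le> b i" if "i \<in> I" for i
    using v that by (auto simp: extreme_point_of_def)
  have "\<forall>\<^sub>F t in at_right 0. a i \<bullet> (v - t *\<^sub>R d) \<le> b i \<and> a i \<bullet> (v + t *\<^sub>R d) \<le> b i"
    if i: "i \<in> I" for i
  proof (cases "a i \<bullet> v = b i")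
    case True
    then show ?thesis using d[OF i] by (simp add: inner_diff_right inner_add_right)
  next
    case False
    then have less: "a i \<bullet> v < b i" using vP[OF i] by simp
    have "((\<lambda>t. a i \<bullet> (v - t *\<^sub>R d)) \<longlongrightarrow> a i \<bullet> (v - 0 *\<^sub>R d)) (at_right 0)"
         "((\<lambda>t. a i \<bullet> (v + t *\<^sub>R d)) \<longlongrightarrow> a i \<bullet> (v + 0 *\<^sub>R d)) (at_right 0)"
      by (intro tendsto_intros)+
    then have "\<forall>\<^sub>F t in at_right 0. a i \<bullet> (v - t *\<^sub>R d) < b i"
              "\<forall>\<^sub>F t in at_right 0. a i \<bullet> (v + t *\<^sub>R d) < b i"
      using less by (auto elim!: order_tendstoD(2))
    then show ?thesis by eventually_elim simp
  qed
  then have "\<forall>\<^sub>F t in at_right 0. \<forall>i\<in>I. a i \<bullet> (v - t *\<^sub>R d) \<le> b i \<and> a i \<bullet> (v + t *\<^sub>R d) \<le> b i"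
    using \<open>finite I\<close> by (simp add: eventually_ball_finite)
  then have "\<forall>\<^sub>F t in at_right 0. (0::real) < t \<and> v - t *\<^sub>R d \<in> ?P \<and> v + t *\<^sub>R d \<in> ?P"
    using eventually_at_right_less by eventually_elim auto
  then obtain t :: real where t: "0 < t" "v - t *\<^sub>R d \<in> ?P" "v + t *\<^sub>R d \<in> ?P"
    using eventually_happens'[OF trivial_limit_at_right_real] by blast
  have "v - t *\<^sub>R d \<noteq> v + t *\<^sub>R d"
  proof
    assume eq: "v - t *\<^sub>R d = v + t *\<^sub>R d"
    have "2 *\<^sub>R (t *\<^sub>R d) = (v + t *\<^sub>R d) - (v - t *\<^sub>R d)" unfolding scaleR_2 by simp
    also have "\<dots> = 0" unfolding eq by simp
    finally have "t *\<^sub>R d = 0" by simp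
    with \<open>d \<noteq> 0\<close> t(1) show False by simp
  qed
  then have "midpoint (v - t *\<^sub>R d) (v + t *\<^sub>R d) \<in> open_segment (v - t *\<^sub>R d) (v + t *\<^sub>R d)"
    by simp
  moreover have "(v - t *\<^sub>R d) + (v + t *\<^sub>R d) = 2 *\<^sub>R v" unfolding scaleR_2 by simp
  then have "midpoint (v - t *\<^sub>R d) (v + t *\<^sub>R d) = v" by (simp add: midpoint_def)
  ultimately have "v \<in> open_segment (v - t *\<^sub>R d) (v + t *\<^sub>R d)" by simp
  moreover have "\<forall>p\<in>?P. \<forall>q\<in>?P. v \<notin> open_segment p q"
    using v unfolding extreme_point_of_def by (elim conjE)
  ultimately show False using t(2,3) by blast
qed

section \<open>Lattice vectors\<close>

text \<open>Integer combinations of vectors form a module over the integers; its span is the subgroup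
  generated by a set, which is what a lattice basis is about.\<close>

interpretation int_module: module "\<lambda>(k::int) (v::real^'n). of_int k *\<^sub>R v"
  by unfold_locales (simp_all add: algebra_simps)

lemma primitive_vector_unit_entry:
  assumes "v \<in> integral_vectors" and "\<bar>v $ i\<bar> = 1"
  shows "primitive_vector v"
  unfolding primitive_vector_def
proof (intro conjI allI ballI impI)
  fix k :: int and u :: "real ^ 'a"
  assume u: "u \<in> integral_vectors" and v: "v = of_int k *\<^sub>R u"
  obtain m where "u $ i = of_int m"
    using u by (auto simp: integral_vectors_def elim: Ints_cases)
  then have "\<bar>of_int (k * m) :: real\<bar> = 1" using assms(2) v by simp
  then have "\<bar>k * m\<bar> = 1" by linarith
  then show "\<bar>k\<bar> = 1" by (auto simp: abs_mult zmult_eq_1_iff)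
qed (fact assms(1))

text \<open>This also covers \<open>k = 0\<close>: it says that a primitive vector is nonzero.\<close>

lemma primitive_vector_common_divisor:
  fixes v :: "real ^ 'n"
  assumes "primitive_vector v" and "\<And>i. v $ i = of_int (\<alpha> i)" and "\<And>i. k dvd \<alpha> i"
  shows "\<bar>k\<bar> = 1"
proof -
  define u :: "real ^ 'n" where "u = (\<chi> i. of_int (\<alpha> i div k))"
  have "of_int (\<alpha> i) = (of_int k :: real) * of_int (\<alpha> i div k)" for i
    using assms(3)[of i] by (metis dvd_mult_div_cancel of_int_mult)
  then have "v = of_int k *\<^sub>R u"
    using assms(2) by (simp add: vec_eq_iff u_def)
  moreover have "u \<in> integral_vectors"
    by (simp add: integral_vectors_def u_def)
  ultimately show ?thesis
    using assms(1) unfolding primitive_vector_def by blast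
qed

text \<open>The factor is rational because \<open>v\<close> has a nonzero integral entry. If it is \<open>m / n\<close> in lowest
  terms, up to sign, then \<open>n\<close> divides all entries of \<open>v\<close> and \<open>m\<close> all entries of \<open>w\<close>.\<close>

lemma primitive_vector_multiple:
  fixes v w :: "real ^ 'n"
  assumes v: "primitive_vector v" and w: "primitive_vector w" and c: "w = c *\<^sub>R v"
  shows "\<bar>c\<bar> = 1"
proof -
  have "\<exists>\<alpha>. \<forall>i. u $ i = of_int (\<alpha> i)" if "primitive_vector u" for u :: "real ^ 'n"
  proof (intro choice allI)
    fix i
    have "u $ i \<in> \<int>"
      using that by (simp add: primitive_vector_def integral_vectors_def)
    then show "\<exists>k. u $ i = of_int k" by (auto elim: Ints_cases)
  qed
  from this[OF v] this[OF w] obtain \<alpha> \<beta>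
    where \<alpha>: "\<And>i. v $ i = of_int (\<alpha> i)" and \<beta>: "\<And>i. w $ i = of_int (\<beta> i)"
    by auto
  have "\<exists>i. \<alpha> i \<noteq> 0"
  proof (rule ccontr)
    assume "\<nexists>i. \<alpha> i \<noteq> 0"
    then show False using primitive_vector_common_divisor[OF v \<alpha>, of 0] by simp
  qed
  then obtain i where "\<alpha> i \<noteq> 0" by blast
  moreover have "of_int (\<beta> i) = c * of_int (\<alpha> i)"
    using c by (simp flip: \<alpha> \<beta>)
  ultimately have "c = of_int (\<beta> i) / of_int (\<alpha> i)" by simp
  then have "c \<in> \<rat>" by simp
  then obtain m n :: nat where mn: "n \<noteq> 0" "\<bar>c\<bar> = real m / real n" "coprime m n"
    by (rule Rats_abs_nat_div_natE)
  have eq: "int n * \<bar>\<beta> j\<bar> = int m * \<bar>\<alpha> j\<bar>" for j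
  proof -
    have "of_int (\<beta> j) = c * of_int (\<alpha> j)"
      using c by (simp flip: \<alpha> \<beta>)
    then have "\<bar>of_int (\<beta> j)\<bar> = real m / real n * \<bar>of_int (\<alpha> j)\<bar>"
      by (simp add: abs_mult mn(2))
    then have "real n * \<bar>of_int (\<beta> j)\<bar> = real m * \<bar>of_int (\<alpha> j)\<bar>"
      using mn(1) by (simp add: field_simps)
    then have "(of_int (int n * \<bar>\<beta> j\<bar>) :: real) = of_int (int m * \<bar>\<alpha> j\<bar>)" by simp
    then show ?thesis by (simp only: of_int_eq_iff)
  qed
  have cop: "coprime (int m) (int n)" using mn(3) by simp
  have "int n dvd \<alpha> j" for j
    using eq[of j] cop by (metis coprime_commute coprime_dvd_mult_right_iff dvd_abs_iff dvd_triv_left)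
  then have "\<bar>int n\<bar> = 1" by (rule primitive_vector_common_divisor[OF v \<alpha>])
  moreover have "int m dvd \<beta> j" for j
    using eq[of j] cop by (metis coprime_dvd_mult_right_iff dvd_abs_iff dvd_triv_left)
  then have "\<bar>int m\<bar> = 1" by (rule primitive_vector_common_divisor[OF w \<beta>])
  ultimately show ?thesis using mn(2) by simp
qed

text \<open>Both equations cut out the hyperplane spanned by \<open>F\<close>, so the conormals are proportional, and
  being primitive they agree up to sign. Opposite signs would confine \<open>P\<close> to that hyperplane.\<close>

lemma conormal_of_facet_unique:
  fixes P :: "(real ^ 'n) set"
  assumes int: "interior P \<noteq> {}"
    and con: "conormal_of_facet P F \<eta> \<kappa>" and con': "conormal_of_facet P F \<eta>' \<kappa>'"
  shows "\<eta>' = \<eta>" and "\<kappa>' = \<kappa>"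
proof -
  have F: "F facet_of P" and prim: "primitive_vector \<eta>" "primitive_vector \<eta>'"
    and le: "\<And>x. x \<in> P \<Longrightarrow> \<eta> \<bullet> x \<le> \<kappa>" "\<And>x. x \<in> P \<Longrightarrow> \<eta>' \<bullet> x \<le> \<kappa>'"
    and sub: "F \<subseteq> {x. \<eta> \<bullet> x = \<kappa>}" "F \<subseteq> {x. \<eta>' \<bullet> x = \<kappa>'}"
    using con con' by (auto simp: conormal_of_facet_def)
  have nz: "u \<noteq> 0" if "primitive_vector u" for u :: "real ^ 'n"
    using primitive_vector_common_divisor[OF that, of "\<lambda>_. 0" 0] by auto
  have hyp: "{x. \<eta> \<bullet> x = \<kappa>} = {x. \<eta>' \<bullet> x = \<kappa>'}"
    using affine_hull_facet[OF F int sub(1) nz[OF prim(1)]]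
      affine_hull_facet[OF F int sub(2) nz[OF prim(2)]] by simp
  from F obtain p where p: "p \<in> F" by (auto simp: facet_of_def)
  have perp: "\<eta>' \<bullet> d = 0" if "\<eta> \<bullet> d = 0" for d
  proof -
    have "p + d \<in> {x. \<eta> \<bullet> x = \<kappa>}" using p sub(1) that by (auto simp: inner_add_right)
    then have "\<eta>' \<bullet> (p + d) = \<kappa>'" unfolding hyp by simp
    then show ?thesis using p sub(2) by (auto simp: inner_add_right)
  qed
  \<comment> \<open>the part of \<open>\<eta>'\<close> orthogonal to \<open>\<eta>\<close> is orthogonal to \<open>\<eta>'\<close> as well, hence zero\<close>
  define c where "c = \<eta>' \<bullet> \<eta> / (\<eta> \<bullet> \<eta>)"
  have "\<eta> \<bullet> (\<eta>' - c *\<^sub>R \<eta>) = 0"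
    using nz[OF prim(1)] by (simp add: c_def inner_diff_right inner_commute)
  then have "(\<eta>' - c *\<^sub>R \<eta>) \<bullet> (\<eta>' - c *\<^sub>R \<eta>) = 0"
    using perp by (simp add: inner_diff_left)
  then have c: "\<eta>' = c *\<^sub>R \<eta>" by simp
  have "\<bar>c\<bar> = 1" by (rule primitive_vector_multiple[OF prim c])
  moreover have "c \<noteq> -1"
  proof
    assume "c = -1"
    then have "\<eta>' = - \<eta>" using c by simp
    moreover have "\<eta> \<bullet> p = \<kappa>" "\<eta>' \<bullet> p = \<kappa>'" using p sub by auto
    ultimately have "\<eta> \<bullet> x = \<kappa>" if "x \<in> P" for x using le[OF that] by simp
    then have "interior P \<subseteq> interior {x. \<eta> \<bullet> x = \<kappa>}" by (intro interior_mono) auto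
    then show False using int nz[OF prim(1)] by simp
  qed
  ultimately have "c = 1" by auto
  then show "\<eta>' = \<eta>" using c by simp
  then show "\<kappa>' = \<kappa>" using p sub by auto
qed

text \<open>Generating the coordinate vectors over the integers makes \<open>B\<close> generate the lattice, hence
  also the real space; the cardinality then forces linear independence.\<close>

lemma lattice_basis_if_int_span:
  fixes B :: "(real ^ 'n) set"
  assumes B: "B \<subseteq> integral_vectors" "finite B" "card B = CARD('n)"
    and axes: "\<And>i. axis i 1 \<in> int_module.span B"
  shows "lattice_basis B"
proof -
  have span: "integral_vectors \<subseteq> int_module.span B"
  proof
    fix v :: "real ^ 'n"
    assume "v \<in> integral_vectors"
    then have "\<exists>k. v $ i = of_int k" for i
      by (auto simp: integral_vectors_def elim: Ints_cases)
    then obtain \<alpha> where \<alpha>: "\<And>i. v $ i = of_int (\<alpha> i)" by metis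
    have "v = (\<Sum>i\<in>UNIV. of_int (\<alpha> i) *\<^sub>R axis i 1)"
      by (simp add: vec_eq_iff \<alpha> axis_def if_distrib cong: if_cong)
    then show "v \<in> int_module.span B"
      using axes by (simp add: int_module.span_sum int_module.span_scale)
  qed
  have comb: "\<exists>c :: real ^ 'n \<Rightarrow> int. v = (\<Sum>b\<in>B. of_int (c b) *\<^sub>R b)"
    if "v \<in> int_module.span B" for v
    using that by (auto simp: int_module.span_finite[OF B(2)])
  have "axis i 1 \<in> span B" for i
  proof -
    from comb[OF axes[of i]] obtain c :: "real ^ 'n \<Rightarrow> int"
      where "axis i 1 = (\<Sum>b\<in>B. of_int (c b) *\<^sub>R b)" by blast
    then show ?thesis by (simp add: span_sum span_scale span_base)
  qed
  then have "(Basis :: (real ^ 'n) set) \<subseteq> span B" by (auto simp: Basis_vec_def)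
  then have "span Basis \<subseteq> span B" by (rule span_minimal) (rule subspace_span)
  then have "independent B"
    using B by (intro card_le_dim_spanning[of B UNIV]) auto
  then show ?thesis
    using B span comb unfolding lattice_basis_def by blast
qed

section \<open>The conormals of the polytope\<close>

lemma exhaust_6:
  fixes x :: 6
  shows "x = 1 \<or> x = 2 \<or> x = 3 \<or> x = 4 \<or> x = 5 \<or> x = 6"
proof (induct x)
  case (of_int z)
  then have "z = 0 \<or> z = 1 \<or> z = 2 \<or> z = 3 \<or> z = 4 \<or> z = 5" by fastforce
  then show ?case by auto
qed

lemma forall_6: "(\<forall>i::6. P i) \<longleftrightarrow> P 1 \<and> P 2 \<and> P 3 \<and> P 4 \<and> P 5 \<and> P 6"
  by (metis exhaust_6)

lemma UNIV_6: "UNIV = {1, 2, 3, 4, 5, 6::6}"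
  using exhaust_6 by auto

lemma sum_6: "sum f (UNIV::6 set) = f 1 + f 2 + f 3 + f 4 + f 5 + f 6"
  unfolding UNIV_6 by (simp add: ac_simps)

lemma vector_6 [simp]:
  "(vector [a,b,c,d,e,f] :: 'a::zero ^ 6) $ 1 = a"
  "(vector [a,b,c,d,e,f] :: 'a::zero ^ 6) $ 2 = b"
  "(vector [a,b,c,d,e,f] :: 'a::zero ^ 6) $ 3 = c"
  "(vector [a,b,c,d,e,f] :: 'a::zero ^ 6) $ 4 = d"
  "(vector [a,b,c,d,e,f] :: 'a::zero ^ 6) $ 5 = e"
  "(vector [a,b,c,d,e,f] :: 'a::zero ^ 6) $ 6 = f"
  unfolding vector_def by simp_all

text \<open>The first conormal is written with \<open>Suc 0\<close>, the normal form of the index 1 under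
  simplification; likewise for the intervals and inner products below.\<close>

lemma eta_vector:
  "eta (Suc 0) = vector [-1, 0, 0, 0, 0, 0]" "eta 2 = vector [0, -1, 0, 0, 0, 0]"
  "eta 3 = vector [0, 0, -1, 0, 0, 0]" "eta 4 = vector [0, 0, 0, -1, 0, 0]"
  "eta 5 = vector [0, 0, 0, 0, -1, 0]" "eta 6 = vector [0, 0, 0, 0, 0, -1]"
  "eta 7 = vector [0, 0, 0, 0, 0, 1]" "eta 8 = vector [1, 1, 0, 0, 1, 3]"
  "eta 9 = vector [0, 0, 1, 1, 1, 2]"
  by (simp_all add: eta_def vec_eq_iff forall_6 axis_def)

lemma eta_inner [simp]:
  "eta (Suc 0) \<bullet> x = - x$1" "eta 2 \<bullet> x = - x$2" "eta 3 \<bullet> x = - x$3"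
  "eta 4 \<bullet> x = - x$4" "eta 5 \<bullet> x = - x$5" "eta 6 \<bullet> x = - x$6" "eta 7 \<bullet> x = x$6"
  "eta 8 \<bullet> x = x$1 + x$2 + x$5 + 3 * x$6" "eta 9 \<bullet> x = x$3 + x$4 + x$5 + 2 * x$6"
  by (simp_all add: eta_vector inner_vec_def sum_6)

lemma interval_9: "{Suc 0..9} = {Suc 0, 2, 3, 4, 5, 6, 7, 8, 9::nat}"
  by auto


lemma Delta_iff:
  "x \<in> Delta \<longleftrightarrow> -1 \<le> x$1 \<and> -1 \<le> x$2 \<and> -1 \<le> x$3 \<and> -1 \<le> x$4 \<and> -1 \<le> x$5 \<and> -1 \<le> x$6 \<and> x$6 \<le> 1
    \<and> x$1 + x$2 + x$5 + 3 * x$6 \<le> 1 \<and> x$3 + x$4 + x$5 + 2 * x$6 \<le> 1"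
  unfolding Delta_def by (auto simp: interval_9)

lemma eta_integral: "i \<in> {1..9} \<Longrightarrow> eta i \<in> integral_vectors"
  by (auto simp: interval_9 eta_vector integral_vectors_def forall_6)

lemma eta_primitive: "i \<in> {1..9} \<Longrightarrow> primitive_vector (eta i)"
proof -
  assume i: "i \<in> {1..9}"
  have "\<exists>j. \<bar>eta i $ j\<bar> = 1"
  proof (rule ccontr)
    assume "\<nexists>j. \<bar>eta i $ j\<bar> = 1"
    then have "\<forall>j. \<bar>eta i $ j\<bar> \<noteq> 1" by blast
    then show False using i by (auto simp: interval_9 eta_vector forall_6)
  qed
  then show ?thesis using eta_integral[OF i] primitive_vector_unit_entry by blast
qed

lemma eta_irredundant:
  assumes "i \<in> {1..9}"
  shows "\<exists>x. eta i \<bullet> x > 1 \<and> (\<forall>j\<in>{1..9} - {i}. eta j \<bullet> x \<le> 1)"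
proof -
  \<comment> \<open>Moving far along a coordinate axis violates a single inequality, except for \<open>i = 7\<close>:
    raising \<open>x 6\<close> above 1 has to be compensated in the last two inequalities, and the slack that
    remains there at the corner -1 of the other coordinates leaves room up to \<open>4 / 3\<close>.\<close>
  define x :: "real ^ 6" where "x =
    (if i = 7 then vector [-1, -1, -1, -1, -1, 7/6]
     else if i = 8 then axis 1 2 else if i = 9 then axis 3 2 else axis (of_nat i) (-2))"
  have "eta i \<bullet> x > 1 \<and> (\<forall>j\<in>{1..9} - {i}. eta j \<bullet> x \<le> 1)"
    using assms unfolding One_nat_def interval_9
    by (elim insertE emptyE) (simp_all add: x_def axis_def insert_Diff_if)
  then show ?thesis by blast
qed

lemma inj_on_eta: "inj_on eta {1..9}"
proof (rule inj_onI, rule ccontr)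
  fix i j :: nat assume ij: "i \<in> {1..9}" "j \<in> {1..9}" "eta i = eta j" "i \<noteq> j"
  from eta_irredundant[OF ij(1)] obtain x where "eta i \<bullet> x > 1" "\<forall>j\<in>{1..9} - {i}. eta j \<bullet> x \<le> 1"
    by blast
  with ij show False by force
qed

lemma zero_in_interior_Delta: "0 \<in> interior Delta"
proof (rule interiorI)
  have "{x. \<forall>i\<in>{1..9}. eta i \<bullet> x < 1} = (\<Inter>i\<in>{1..9}. {x. eta i \<bullet> x < 1})" by auto
  moreover have "open \<dots>"
    by (intro open_INT ballI open_halfspace_lt) simp
  ultimately show "open {x. \<forall>i\<in>{1..9}. eta i \<bullet> x < 1}" by simp
qed (auto simp: Delta_def intro: less_imp_le)

lemma facet_of_Delta: "F facet_of Delta \<longleftrightarrow> (\<exists>i\<in>{1..9}. F = Delta_facet i)"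
  unfolding Delta_facet_def
proof (rule facet_of_irredundant_system)
  show "interior Delta \<noteq> {}" using zero_in_interior_Delta by blast
qed (use eta_irredundant in \<open>auto simp: Delta_def\<close>)

lemma conormal_Delta_facet:
  assumes "i \<in> {1..9}"
  shows "conormal_of_facet Delta (Delta_facet i) (eta i) 1"
  using assms facet_of_Delta eta_primitive
  by (auto simp: conormal_of_facet_def Delta_facet_def Delta_def)

lemma conormal_of_facet_Delta:
  "conormal_of_facet Delta F \<eta> \<kappa> \<longleftrightarrow> (\<exists>i\<in>{1..9}. F = Delta_facet i \<and> \<eta> = eta i) \<and> \<kappa> = 1"
proof
  assume con: "conormal_of_facet Delta F \<eta> \<kappa>"
  then have "F facet_of Delta" unfolding conormal_of_facet_def by (elim conjE)
  then obtain i where i: "i \<in> {1..9}" "F = Delta_facet i" by (auto simp: facet_of_Delta)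
  have "interior Delta \<noteq> {}" using zero_in_interior_Delta by blast
  from conormal_of_facet_unique[OF this conormal_Delta_facet[OF i(1)] con[unfolded i(2)]] i
  show "(\<exists>i\<in>{1..9}. F = Delta_facet i \<and> \<eta> = eta i) \<and> \<kappa> = 1" by blast
qed (auto intro: conormal_Delta_facet)

lemma inj_on_Delta_facet: "inj_on Delta_facet {1..9}"
proof (rule inj_onI)
  fix i j assume ij: "i \<in> {1..9}" "j \<in> {1..9}" "Delta_facet i = Delta_facet j"
  have "interior Delta \<noteq> {}" using zero_in_interior_Delta by blast
  from conormal_of_facet_unique(1)[OF this conormal_Delta_facet[OF ij(1)]] conormal_Delta_facet[OF ij(2)]
  have "eta j = eta i" using ij(3) by simp
  then show "i = j" using inj_on_eta ij by (auto dest: inj_onD)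
qed

lemma polytope_Delta: "polytope Delta"
proof -
  have "Delta = \<Inter> ((\<lambda>i. {x. eta i \<bullet> x \<le> 1}) ` {1..9})"
    by (auto simp: Delta_def)
  moreover have "polyhedron \<dots>"
    by (rule polyhedron_Inter) (auto intro: polyhedron_halfspace_le)
  ultimately have "polyhedron Delta" by simp
  moreover have "Delta \<subseteq> cbox (\<chi> i. -1) (\<chi> i. 10)"
    by (auto simp: Delta_iff mem_box_cart forall_6)
  then have "bounded Delta" using bounded_cbox bounded_subset by blast
  ultimately show ?thesis by (simp add: polytope_eq_bounded_polyhedron)
qed

section \<open>The vertices of the polytope\<close>

text \<open>The three relations between the conormals are the only constraints on the values that they
  take on a vector.\<close>

lemma eta_inner_prescribed:
  fixes \<delta> :: "nat \<Rightarrow> real"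
  assumes "\<delta> 6 + \<delta> 7 = 0" "\<delta> 1 + \<delta> 2 + \<delta> 8 + \<delta> 5 + 3 * \<delta> 6 = 0"
    "\<delta> 3 + \<delta> 4 + \<delta> 9 + \<delta> 5 + 2 * \<delta> 6 = 0"
  obtains d where "\<And>i. i \<in> {1..9} \<Longrightarrow> eta i \<bullet> d = \<delta> i"
proof
  fix i :: nat assume "i \<in> {1..9}"
  then show "eta i \<bullet> vector [- \<delta> 1, - \<delta> 2, - \<delta> 3, - \<delta> 4, - \<delta> 5, - \<delta> 6] = \<delta> i"
    using assms by (auto simp: interval_9)
qed

lemma vertex_rigid:
  fixes \<delta> :: "nat \<Rightarrow> real"
  assumes v: "v extreme_point_of Delta"
    and rel: "\<delta> 6 + \<delta> 7 = 0" "\<delta> 1 + \<delta> 2 + \<delta> 8 + \<delta> 5 + 3 * \<delta> 6 = 0"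
      "\<delta> 3 + \<delta> 4 + \<delta> 9 + \<delta> 5 + 2 * \<delta> 6 = 0"
    and active: "\<And>i. i \<in> {1..9} \<Longrightarrow> eta i \<bullet> v = 1 \<Longrightarrow> \<delta> i = 0"
    and i: "i \<in> {1..9}"
  shows "\<delta> i = 0"
proof -
  from eta_inner_prescribed[OF rel] obtain d where d: "\<And>i. i \<in> {1..9} \<Longrightarrow> eta i \<bullet> d = \<delta> i"
    by blast
  have "d = 0"
    by (rule extreme_point_no_direction[of "{1..9::nat}" v eta "\<lambda>_. 1"])
      (use v d active in \<open>auto simp: Delta_def\<close>)
  then show ?thesis using d[OF i] by simp
qed

text \<open>These are the bases of the system of three slack equations in nine unknowns whose coefficient
  columns are those of the relations. Not all of them are feasible (no point of the polytope has
  the support \<open>{b, 5, 7}\<close>), but all of them are unimodular.\<close>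

definition basic_support :: "nat set \<Rightarrow> bool" where
  "basic_support P \<longleftrightarrow> (\<exists>a\<in>{1, 2, 8}. \<exists>b\<in>{3, 4, 9}. \<exists>c\<in>{6, 7}.
     P = {a, b, c} \<or> P = {a, 5, c} \<or> P = {b, 5, c} \<or> P = {5, 6, 7})"

text \<open>Each forbidden combination of positive slacks carries an explicit solution of the homogeneous
  slack equations. On the other hand the right-hand sides 2, 7, 6 are so large that \<open>s 6\<close>, being at
  most 2, cannot account for the second or third one alone.\<close>

lemma vertex_basic_support:
  assumes v: "v extreme_point_of Delta"
  shows "basic_support {i \<in> {1..9}. eta i \<bullet> v \<noteq> 1}"
proof -
  define p where "p i \<longleftrightarrow> eta i \<bullet> v \<noteq> 1" for i
  have vD: "v \<in> Delta" using v by (simp add: extreme_point_of_def)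
  have rigid: "\<exists>j. \<delta> j \<noteq> 0 \<and> \<not> p j"
    if "\<delta> 6 + \<delta> 7 = 0" "\<delta> 1 + \<delta> 2 + \<delta> 8 + \<delta> 5 + 3 * \<delta> 6 = 0"
      "\<delta> 3 + \<delta> 4 + \<delta> 9 + \<delta> 5 + 2 * \<delta> 6 = 0" "i \<in> {1..9}" "\<delta> i \<noteq> 0"
    for \<delta> :: "nat \<Rightarrow> real" and i
    using vertex_rigid[OF v that(1-3) _ that(4)] that(5) by (auto simp: p_def)
  define A B C :: "nat set" where "A = {1, 2, 8}" and "B = {3, 4, 9}" and "C = {6, 7}"
  note ABC = A_def B_def C_def
  have aa: "\<not> (p a \<and> p a')" if "a \<in> A" "a' \<in> A" "a \<noteq> a'" for a a'
    using that rigid[of "(\<lambda>_. 0)(a := 1, a' := -1)" a] by (auto simp: ABC split: if_splits)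
  have bb: "\<not> (p b \<and> p b')" if "b \<in> B" "b' \<in> B" "b \<noteq> b'" for b b'
    using that rigid[of "(\<lambda>_. 0)(b := 1, b' := -1)" b] by (auto simp: ABC split: if_splits)
  have ab5: "\<not> (p a \<and> p b \<and> p 5)" if "a \<in> A" "b \<in> B" for a b
    using that rigid[of "(\<lambda>_. 0)(5 := 1, a := -1, b := -1)" 5] by (auto simp: ABC split: if_splits)
  have ab67: "\<not> (p a \<and> p b \<and> p 6 \<and> p 7)" if "a \<in> A" "b \<in> B" for a b
    using that rigid[of "(\<lambda>_. 0)(6 := 1, 7 := -1, a := -3, b := -2)" 6]
    by (auto simp: ABC split: if_splits)
  have a567: "\<not> (p a \<and> p 5 \<and> p 6 \<and> p 7)" if "a \<in> A" for a
    using that rigid[of "(\<lambda>_. 0)(6 := 1, 7 := -1, 5 := -2, a := -1)" 6]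
    by (auto simp: ABC split: if_splits)
  have b567: "\<not> (p b \<and> p 5 \<and> p 6 \<and> p 7)" if "b \<in> B" for b
    using that rigid[of "(\<lambda>_. 0)(6 := 1, 7 := -1, 5 := -3, b := 1)" 6]
    by (auto simp: ABC split: if_splits)
  have p67: "p 6 \<or> p 7" by (auto simp: p_def)
  have pa: "p 5 \<or> (\<exists>a\<in>A. p a)" using vD by (auto simp: ABC p_def Delta_iff)
  have pb: "p 5 \<or> (\<exists>b\<in>B. p b)" using vD by (auto simp: ABC p_def Delta_iff)
  \<comment> \<open>here \<open>s 5\<close> equals both \<open>7 - 3 s 6\<close> and \<open>6 - 2 s 6\<close>, so \<open>s 6 = 1\<close>\<close>
  have p5: "p 6 \<and> p 7" if "\<forall>a\<in>A. \<not> p a" "\<forall>b\<in>B. \<not> p b"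
    using that p67 by (auto simp: ABC p_def)
  define P where "P = {i \<in> {1..9}. p i}"
  have "{1..9} = A \<union> B \<union> {5} \<union> C" by (auto simp: ABC)
  then have P: "P = {i \<in> A. p i} \<union> {i \<in> B. p i} \<union> {i \<in> {5}. p i} \<union> {i \<in> C. p i}"
    by (auto simp: P_def)
  have "\<exists>a\<in>A. \<exists>b\<in>B. \<exists>c\<in>C. P = {a, b, c} \<or> P = {a, 5, c} \<or> P = {b, 5, c} \<or> P = {5, 6, 7}"
  proof -
    have PA: "{i \<in> A. p i} = {a}" if "a \<in> A" "p a" for a using that aa by blast
    have PB: "{i \<in> B. p i} = {b}" if "b \<in> B" "p b" for b using that bb by blast
    have PC: "\<exists>c\<in>C. {i \<in> C. p i} = {c}" if "\<not> (p 6 \<and> p 7)"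
      using that p67 by (auto simp: C_def)
    have ne: "\<exists>a. a \<in> A" "\<exists>b. b \<in> B" "\<exists>c. c \<in> C" by (auto simp: ABC)
    consider a b where "a \<in> A" "b \<in> B" "p a" "p b"
      | a where "a \<in> A" "p a" "p 5" "\<forall>b\<in>B. \<not> p b"
      | b where "b \<in> B" "p b" "p 5" "\<forall>a\<in>A. \<not> p a"
      | "p 5" "\<forall>a\<in>A. \<not> p a" "\<forall>b\<in>B. \<not> p b"
      using pa pb by blast
    then show ?thesis
    proof cases
      case (1 a b)
      obtain c where "c \<in> C" "{i \<in> C. p i} = {c}" using PC ab67 1 by blast
      moreover have "{i \<in> {5}. p i} = {}" using ab5 1 by blast
      ultimately have "P = {a, b, c}" unfolding P using PA[of a] PB[of b] 1 by auto
      then show ?thesis using 1 \<open>c \<in> C\<close> by blast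
    next
      case (2 a)
      obtain c where "c \<in> C" "{i \<in> C. p i} = {c}" using PC a567 2 by blast
      then have "P = {a, 5, c}" unfolding P using PA[of a] 2 by auto
      then show ?thesis using 2 \<open>c \<in> C\<close> ne by blast
    next
      case (3 b)
      obtain c where "c \<in> C" "{i \<in> C. p i} = {c}" using PC b567 3 by blast
      then have "P = {b, 5, c}" unfolding P using PB[of b] 3 by auto
      then show ?thesis using 3 \<open>c \<in> C\<close> ne by blast
    next
      case 4
      then have "P = {5, 6, 7}" unfolding P using p5 by (auto simp: C_def)
      moreover obtain a b c where "a \<in> A" "b \<in> B" "c \<in> C" using ne by blast
      ultimately show ?thesis by (intro bexI[of _ a] bexI[of _ b] bexI[of _ c]) simp_all
    qed
  qed
  then have "basic_support P" unfolding basic_support_def ABC .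
  then show ?thesis by (simp only: P_def p_def)
qed

text \<open>The three relations solved for single conormals. The last equation is the difference of the
  second and third relation; the coefficient of \<open>eta 6\<close> there is \<open>3 - 2 = 1\<close>, which is why the
  vertex with positive slacks 5, 6, 7 is unimodular.\<close>

lemma eta_relations_solved:
  "eta 7 = - eta 6" "eta 6 = - eta 7"
  "eta 1 = - (eta 2 + eta 8 + eta 5 + 3 *\<^sub>R eta 6)"
  "eta 2 = - (eta 1 + eta 8 + eta 5 + 3 *\<^sub>R eta 6)"
  "eta 8 = - (eta 1 + eta 2 + eta 5 + 3 *\<^sub>R eta 6)"
  "eta 3 = - (eta 4 + eta 9 + eta 5 + 2 *\<^sub>R eta 6)"
  "eta 4 = - (eta 3 + eta 9 + eta 5 + 2 *\<^sub>R eta 6)"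
  "eta 9 = - (eta 3 + eta 4 + eta 5 + 2 *\<^sub>R eta 6)"
  "eta 5 = - (eta 1 + eta 2 + eta 8 + 3 *\<^sub>R eta 6)"
  "eta 5 = - (eta 3 + eta 4 + eta 9 + 2 *\<^sub>R eta 6)"
  "eta 6 = eta 3 + eta 4 + eta 9 + - (eta 1 + eta 2 + eta 8)"
  by (simp_all add: eta_vector vec_eq_iff forall_6)

text \<open>Recover the missing conormals in the order \<open>eta 6\<close> and \<open>eta 7\<close>, then \<open>eta 5\<close>, then
  the groups \<open>A\<close> and \<open>B\<close>, in each of which at most one is missing.\<close>

lemma eta_in_vertex_span:
  assumes "basic_support P" and i: "i \<in> {1..9}"
  shows "eta i \<in> int_module.span (eta ` ({1..9} - P))"
proof -
  define A B C :: "nat set" where "A = {1, 2, 8}" and "B = {3, 4, 9}" and "C = {6, 7}"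
  note ABC = A_def B_def C_def
  have disj: "A \<inter> B = {}" "A \<inter> C = {}" "B \<inter> C = {}" "5 \<notin> A" "5 \<notin> B" "5 \<notin> C"
    "6 \<notin> A" "6 \<notin> B" "7 \<notin> A" "7 \<notin> B" by (auto simp: ABC)
  from assms(1) obtain a b c where abc: "a \<in> A" "b \<in> B" "c \<in> C"
    and P: "P = {a, b, c} \<or> P = {a, 5, c} \<or> P = {b, 5, c} \<or> P = {5, 6, 7}"
    unfolding basic_support_def ABC by blast
  have PA: "j = j'" if "j \<in> A \<inter> P" "j' \<in> A \<inter> P" for j j'
    using P abc disj that by blast
  have PB: "j = j'" if "j \<in> B \<inter> P" "j' \<in> B \<inter> P" for j j'
    using P abc disj that by blast
  have P5: "5 \<notin> P \<or> A \<inter> P = {} \<or> B \<inter> P = {}"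
    using P abc disj by blast
  have PC: "6 \<notin> P \<or> 7 \<notin> P \<or> A \<inter> P = {} \<and> B \<inter> P = {}"
  proof (cases "P = {5, 6, 7}")
    case True
    then show ?thesis using disj by blast
  next
    case False
    have "a \<noteq> 6" "a \<noteq> 7" "b \<noteq> 6" "b \<noteq> 7" using abc disj by blast+
    then show ?thesis using False P by (elim disjE) simp_all
  qed
  define L where "L = int_module.span (eta ` ({1..9} - P))"
  have base: "eta j \<in> L" if "j \<in> {1..9}" "j \<notin> P" for j
    unfolding L_def using that by (intro int_module.span_base) blast
  have add: "x + y \<in> L" if "x \<in> L" "y \<in> L" for x y
    using that unfolding L_def by (rule int_module.span_add)
  have neg: "- x \<in> L" if "x \<in> L" for x
    using that unfolding L_def by (rule int_module.span_neg)
  have mult: "2 *\<^sub>R x \<in> L" "3 *\<^sub>R x \<in> L" if "x \<in> L" for x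
    using that int_module.span_scale[of x _ 2] int_module.span_scale[of x _ 3]
    by (auto simp: L_def)
  have E67: "eta 6 \<in> L \<longleftrightarrow> eta 7 \<in> L"
    using neg eta_relations_solved(1,2) by metis
  have EA: "eta j \<in> L" if j: "j \<in> A" and "\<And>k. k \<in> A - {j} \<Longrightarrow> eta k \<in> L" "eta 5 \<in> L" "eta 6 \<in> L" for j
  proof -
    consider "j = 1" | "j = 2" | "j = 8" using j unfolding A_def by blast
    then show ?thesis
    proof cases
      case 1
      show ?thesis unfolding 1 eta_relations_solved(3) by (intro neg add mult that) (simp_all add: 1 A_def)
    next
      case 2
      show ?thesis unfolding 2 eta_relations_solved(4) by (intro neg add mult that) (simp_all add: 2 A_def)
    next
      case 3
      show ?thesis unfolding 3 eta_relations_solved(5) by (intro neg add mult that) (simp_all add: 3 A_def)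
    qed
  qed
  have EB: "eta j \<in> L" if j: "j \<in> B" and "\<And>k. k \<in> B - {j} \<Longrightarrow> eta k \<in> L" "eta 5 \<in> L" "eta 6 \<in> L" for j
  proof -
    consider "j = 3" | "j = 4" | "j = 9" using j unfolding B_def by blast
    then show ?thesis
    proof cases
      case 1
      show ?thesis unfolding 1 eta_relations_solved(6) by (intro neg add mult that) (simp_all add: 1 B_def)
    next
      case 2
      show ?thesis unfolding 2 eta_relations_solved(7) by (intro neg add mult that) (simp_all add: 2 B_def)
    next
      case 3
      show ?thesis unfolding 3 eta_relations_solved(8) by (intro neg add mult that) (simp_all add: 3 B_def)
    qed
  qed
  have E5A: "eta 5 \<in> L" if "\<And>k. k \<in> A \<Longrightarrow> eta k \<in> L" "eta 6 \<in> L"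
    unfolding eta_relations_solved(9) by (intro neg add mult that) (simp_all add: A_def)
  have E5B: "eta 5 \<in> L" if "\<And>k. k \<in> B \<Longrightarrow> eta k \<in> L" "eta 6 \<in> L"
    unfolding eta_relations_solved(10) by (intro neg add mult that) (simp_all add: B_def)
  have E6: "eta 6 \<in> L" if "\<And>k. k \<in> A \<union> B \<Longrightarrow> eta k \<in> L"
    unfolding eta_relations_solved(11) by (intro neg add that) (simp_all add: ABC)
  have all: "{1..9} = A \<union> B \<union> {5} \<union> C" by (auto simp: ABC)
  have baseA: "eta j \<in> L" if "j \<in> A" "j \<notin> P" for j using base that all by blast
  have baseB: "eta j \<in> L" if "j \<in> B" "j \<notin> P" for j using base that all by blast
  have six: "eta 6 \<in> L"
    using PC
  proof (elim disjE conjE)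
    assume "A \<inter> P = {}" "B \<inter> P = {}"
    then show ?thesis using baseA baseB by (intro E6) blast
  qed (use base[of 6] base[of 7] E67 in auto)
  have five: "eta 5 \<in> L"
    using P5
  proof (elim disjE)
    assume "A \<inter> P = {}"
    then show ?thesis using baseA six by (intro E5A) blast+
  next
    assume "B \<inter> P = {}"
    then show ?thesis using baseB six by (intro E5B) blast+
  qed (use base[of 5] in auto)
  have "eta j \<in> L" if "j \<in> A" for j
    using baseA EA[OF that _ five six] PA that by blast
  moreover have "eta j \<in> L" if "j \<in> B" for j
    using baseB EB[OF that _ five six] PB that by blast
  moreover have "eta j \<in> L" if "j \<in> C" for j
    using that six E67 unfolding C_def by blast
  ultimately show ?thesis using i five all unfolding L_def by blast
qed

lemma basic_support_size:
  assumes "basic_support P"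
  shows "P \<subseteq> {1..9}" and "card P = 3"
proof -
  from assms obtain a b c :: nat where abc: "a \<in> {1, 2, 8}" "b \<in> {3, 4, 9}" "c \<in> {6, 7}"
    and P: "P = {a, b, c} \<or> P = {a, 5, c} \<or> P = {b, 5, c} \<or> P = {5, 6, 7}"
    unfolding basic_support_def by blast
  have le: "a \<in> {1..9}" "b \<in> {1..9}" "c \<in> {1..9}" using abc by auto
  have ne: "a \<noteq> b" "a \<noteq> c" "b \<noteq> c" "a \<noteq> 5" "b \<noteq> 5" "c \<noteq> 5" using abc by auto
  show "P \<subseteq> {1..9}" using P by (elim disjE) (use le in simp_all)
  show "card P = 3" using P by (elim disjE) (use ne in simp_all)
qed

lemma facets_through:
  assumes "v \<in> Delta"
  shows "{F. F facet_of Delta \<and> v \<in> F} = Delta_facet ` {i \<in> {1..9}. eta i \<bullet> v = 1}"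
  using assms by (auto simp: facet_of_Delta Delta_facet_def)

lemma conormals_through:
  assumes "v \<in> Delta"
  shows "{\<eta>. \<exists>F \<kappa>. v \<in> F \<and> conormal_of_facet Delta F \<eta> \<kappa>} = eta ` {i \<in> {1..9}. eta i \<bullet> v = 1}"
proof -
  have "v \<in> Delta_facet i \<longleftrightarrow> eta i \<bullet> v = 1" for i using assms by (simp add: Delta_facet_def)
  then show ?thesis unfolding conormal_of_facet_Delta by blast
qed

lemma vertex_Delta:
  assumes v: "v extreme_point_of Delta"
  shows "card {F. F facet_of Delta \<and> v \<in> F} = 6"
    and "lattice_basis {\<eta>. \<exists>F \<kappa>. v \<in> F \<and> conormal_of_facet Delta F \<eta> \<kappa>}"
    and "v \<in> integral_vectors"
proof -
  have vD: "v \<in> Delta" using v by (simp add: extreme_point_of_def)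
  define A where "A = {i \<in> {1..9}. eta i \<bullet> v = 1}"
  define P where "P = {i \<in> {1..9}. eta i \<bullet> v \<noteq> 1}"
  have P: "basic_support P" unfolding P_def using v by (rule vertex_basic_support)
  have A: "A = {1..9} - P" by (auto simp: A_def P_def)
  have card: "card A = 6"
    using basic_support_size[OF P] unfolding A by (simp add: card_Diff_subset finite_subset)
  have sub: "A \<subseteq> {1..9}" by (auto simp: A_def)
  show "card {F. F facet_of Delta \<and> v \<in> F} = 6"
    unfolding facets_through[OF vD] A_def[symmetric]
    using card inj_on_subset[OF inj_on_Delta_facet sub] by (simp add: card_image)
  have in_span: "eta i \<in> int_module.span (eta ` A)" if "i \<in> {1..9}" for i
    unfolding A using P that by (rule eta_in_vertex_span)
  have axis: "axis j 1 \<in> int_module.span (eta ` A)" for j :: 6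
  proof -
    have "\<exists>i\<in>{1, 2, 3, 4, 5, 6}. j = of_nat i" using exhaust_6[of j] by auto
    then obtain i where "i \<in> {1, 2, 3, 4, 5, 6}" and j: "j = of_nat i" by blast
    then have i: "i \<in> {1..6}" by auto
    have "axis j 1 = - eta i" using i j by (simp add: eta_def)
    then show ?thesis using int_module.span_neg[OF in_span[of i]] i by simp
  qed
  have basis: "lattice_basis (eta ` A)"
  proof (rule lattice_basis_if_int_span)
    show "eta ` A \<subseteq> integral_vectors" using eta_integral sub by blast
    show "finite (eta ` A)" using finite_subset[OF sub] by simp
    show "card (eta ` A) = CARD(6)"
      using card inj_on_subset[OF inj_on_eta sub] by (simp add: card_image)
  qed (fact axis)
  then show "lattice_basis {\<eta>. \<exists>F \<kappa>. v \<in> F \<and> conormal_of_facet Delta F \<eta> \<kappa>}"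
    unfolding conormals_through[OF vD] A_def .
  \<comment> \<open>inner products with \<open>v\<close> are integral on the generators, hence on the coordinate vectors\<close>
  have "w \<bullet> v \<in> \<int>" if "w \<in> int_module.span (eta ` A)" for w
    using that
  proof (induction rule: int_module.span_induct_alt)
    case base
    show ?case by simp
  next
    case (step c x y)
    then show ?case by (auto simp: inner_add_left A_def)
  qed
  from this[OF axis] show "v \<in> integral_vectors"
    by (simp add: integral_vectors_def inner_axis')
qed

lemma monotone_polytope_Delta: "monotone_polytope Delta"
  unfolding monotone_polytope_def smooth_polytope_def integral_polytope_def
proof (intro conjI allI impI)
  show "interior Delta \<noteq> {}" using zero_in_interior_Delta by blast
  show "\<exists>\<eta> \<kappa>. conormal_of_facet Delta F \<eta> \<kappa>" if "F facet_of Delta" for F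
    using that conormal_Delta_facet unfolding facet_of_Delta by blast
  show "lattice_basis {\<eta>. \<exists>F \<kappa>. v \<in> F \<and> conormal_of_facet Delta F \<eta> \<kappa>}"
    if "v extreme_point_of Delta" for v
    using that by (rule vertex_Delta(2))
qed (simp_all add: polytope_Delta vertex_Delta(1,3) conormal_of_facet_Delta)

section \<open>Failure of the star-Ewald condition\<close>

lemma integral_vectors_inner:
  assumes "v \<in> integral_vectors" "w \<in> integral_vectors"
  shows "v \<bullet> w \<in> \<int>"
  using assms by (auto simp: integral_vectors_def inner_vec_def)

text \<open>Subtracting the equations for \<open>eta 9\<close> and \<open>eta 8\<close> determines \<open>w $ 6\<close>. If \<open>k\<close> is 1, 2 or 8
  then \<open>w $ 6 = 1\<close> and \<open>w $ 5 = -2\<close>; if \<open>k\<close> is 3, 4 or 9 then \<open>w $ 6 = -1\<close> and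
  \<open>w $ 5 = 3\<close>.\<close>

lemma no_symmetric_point_with_one_active:
  fixes w :: "real ^ 6"
  assumes k: "k \<in> {1, 2, 3, 4, 8, 9}" and active: "eta k \<bullet> w = 1"
    and others: "\<And>i. i \<in> {1, 2, 3, 4, 8, 9} - {k} \<Longrightarrow> eta i \<bullet> w = 0"
    and le: "\<bar>w $ 5\<bar> \<le> 1"
  shows False
proof -
  have e: "eta i \<bullet> w = (if i = k then 1 else 0)" if "i \<in> {1, 2, 3, 4, 8, 9}" for i
    using that active others by auto
  have "w$1 = (if 1 = k then -1 else 0)" "w$2 = (if 2 = k then -1 else 0)"
    "w$3 = (if 3 = k then -1 else 0)" "w$4 = (if 4 = k then -1 else 0)"
    "w$1 + w$2 + w$5 + 3 * w$6 = (if 8 = k then 1 else 0)"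
    "w$3 + w$4 + w$5 + 2 * w$6 = (if 9 = k then 1 else 0)"
    using e[of 1] e[of 2] e[of 3] e[of 4] e[of 8] e[of 9] by (auto split: if_splits)
  then show False using k le by auto
qed

theorem lemma2p6:
  "monotone_polytope Delta \<and>
   (\<forall>i \<in> {1..9}. conormal_of_facet Delta (Delta_facet i) (eta i) 1) \<and>
   (\<exists>z. Delta_facet 1 \<inter> Delta_facet 2 \<inter> Delta_facet 3 \<inter> Delta_facet 4
           \<inter> Delta_facet 8 \<inter> Delta_facet 9 = {z} \<and>
        z extreme_point_of Delta \<and>
        \<not> star_Ewald_at Delta z)"
proof (intro conjI ballI exI)
  show "monotone_polytope Delta" by (rule monotone_polytope_Delta)
  show "conormal_of_facet Delta (Delta_facet i) (eta i) 1" if "i \<in> {1..9}" for i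
    using that by (rule conormal_Delta_facet)
  define z :: "real ^ 6" where "z = vector [-1, -1, -1, -1, 3, 0]"
  let ?I = "{1, 2, 3, 4, 8, 9} :: nat set"
  show inter: "Delta_facet 1 \<inter> Delta_facet 2 \<inter> Delta_facet 3 \<inter> Delta_facet 4
           \<inter> Delta_facet 8 \<inter> Delta_facet 9 = {z}"
    by (auto simp: Delta_facet_def Delta_iff z_def vec_eq_iff forall_6)
  have face: "Delta_facet i face_of Delta" if "i \<in> {1..9}" for i
    using that facet_of_Delta facet_of_imp_face_of by blast
  have "{z} face_of Delta"
    unfolding inter[symmetric] by (intro face_of_Int face) auto
  then show "z extreme_point_of Delta" by (simp add: face_of_singleton)
  have through: "F facet_of Delta \<and> z \<in> F \<longleftrightarrow> (\<exists>i\<in>?I. F = Delta_facet i)" for F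
  proof -
    have "z \<in> Delta_facet i \<longleftrightarrow> i \<in> ?I" if "i \<in> {1..9}" for i
      using that unfolding One_nat_def interval_9
      by (auto simp: Delta_facet_def Delta_iff z_def)
    moreover have "?I \<subseteq> {1..9}" by auto
    ultimately show ?thesis unfolding facet_of_Delta by blast
  qed
  show "\<not> star_Ewald_at Delta z"
  proof
    assume "star_Ewald_at Delta z"
    then obtain w where w: "w \<in> symmetric_points Delta"
      and one: "\<exists>!F. F facet_of Delta \<and> z \<in> F \<and> w \<in> F"
      and none: "\<And>F. F facet_of Delta \<Longrightarrow> z \<in> F \<Longrightarrow> - w \<notin> F"
      unfolding star_Ewald_at_def by blast
    have wD: "w \<in> Delta" "- w \<in> Delta" and int: "w \<in> integral_vectors"
      using w by (auto simp: symmetric_points_def)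
    have in_facet: "x \<in> Delta_facet i \<longleftrightarrow> eta i \<bullet> x = 1" if "x \<in> Delta" for x i
      using that by (simp add: Delta_facet_def)
    from one through obtain k where k: "k \<in> ?I" "w \<in> Delta_facet k"
      and uniq: "\<And>i. i \<in> ?I \<Longrightarrow> w \<in> Delta_facet i \<Longrightarrow> Delta_facet i = Delta_facet k"
      by metis
    show False
    proof (rule no_symmetric_point_with_one_active)
      show "eta k \<bullet> w = 1" using k(2) by (simp add: Delta_facet_def)
      show "\<bar>w $ 5\<bar> \<le> 1" using wD by (simp add: Delta_iff abs_le_iff)
      fix i assume i: "i \<in> ?I - {k}"
      then have "i \<in> {1..9}" "k \<in> {1..9}" "i \<noteq> k" using k(1) by auto
      then have "Delta_facet i \<noteq> Delta_facet k"
        using inj_on_Delta_facet by (auto dest: inj_onD)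
      then have "eta i \<bullet> w \<noteq> 1" using uniq[of i] i in_facet[OF wD(1)] by blast
      moreover have "- w \<notin> Delta_facet i"
        using none through i by blast
      then have "eta i \<bullet> w \<noteq> -1" using in_facet[OF wD(2)] by simp
      moreover have "eta i \<bullet> w \<le> 1" "eta i \<bullet> (- w) \<le> 1"
        using wD \<open>i \<in> {1..9}\<close> unfolding Delta_def by blast+
      moreover have "eta i \<bullet> w \<in> \<int>"
        using eta_integral[OF \<open>i \<in> {1..9}\<close>] int by (rule integral_vectors_inner)
      then obtain m :: int where "eta i \<bullet> w = of_int m" by (rule Ints_cases)
      ultimately show "eta i \<bullet> w = 0" by simp
    qed (fact k(1))
  qed
qed

end
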